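(* Put $E=\{1,4\}$, $O=\{2,3\}$, $e=\{4\}$, and define a binary relation on $\mathcal P(X)$, $X=\{1,2,3,4\}$, by $$\mathcal R=\{(A,B):H_5^{\#}[A,e,B,e,e]\subseteq e\}.$$ Then $$\mathcal R=(\{\varnothing\}\times\mathcal P(X))\cup(\mathcal P(X)\times\{\varnothing\})\cup\{(A,B):\varnothing\ne A,B\subseteq E\}\cup\{(A,B):\varnothing\ne A,B\subseteq O\}.$$ On singleton atoms it is exactly the parity congruence: for $x,y\in X$, $(\{x\},\{y\})\in\mathcal R\iff x\mathrel\pi y$. The map $\epsilon:X\to\mathbb Z_2$ induces the corresponding strong quotient (that is, $\epsilon$ is a surjective homomorphism from $H_5$ with kernel $\pi$, inducing an isomorphism from $H_5/\pi$), whose five-ary operation is addition $(t_1,\dots,t_5)\mapsto t_1+\dots+t_5$ in $\mathbb Z_2$. The relation $\mathcal R$ is nonrectangular, i.e. it is not of the form $\mathcal U\times\mathcal V$ with $\mathcal U,\mathcal V\subseteq\mathcal P(X)$, and it cannot be defined by a conjunction of conditions each involving only one of the two variables.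
   Context: $X=\{1,2,3,4\}$; $\epsilon:X\to\mathbb Z_2$ with $\epsilon(1)=\epsilon(4)=0$, $\epsilon(2)=\epsilon(3)=1$; $\eta:\mathbb Z_2\to X$ with $\eta(0)=4$, $\eta(1)=3$. $H_5:X^5\to X$ is: $H_5(x_1,\dots,x_5)=1$ if all $x_i=1$; $=2$ if all $x_i=2$; and $=\eta(\epsilon(x_1)+\dots+\epsilon(x_5))$ otherwise (sum in $\mathbb Z_2$). For $A,B,C,D,F\subseteq X$, $H_5^{\#}[A,B,C,D,F]=\{H_5(a,b,c,d,f):a\in A,b\in B,c\in C,d\in D,f\in F\}$. The parity equivalence $\pi$ on $X$ has blocks $\{1,4\}$ and $\{2,3\}$. The notation $\varnothing\ne A,B\subseteq E$ means both $A$ and $B$ are nonempty subsets of $E$ (similarly for $O$). *)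

theory Defs
  imports "HOL-Library.Z2"
begin

text \<open>The base set \<open>X = {1, 2, 3, 4}\<close> is a four-element type, so \<open>\<P>(X)\<close> is the
  type of sets over it; \<open>P1\<close>, ..., \<open>P4\<close> stand for the points \<open>1\<close>, ..., \<open>4\<close>.
  The group \<open>\<int>\<^sub>2\<close> is the two-element field \<^typ>\<open>bit\<close>.\<close>

datatype pt = P1 | P2 | P3 | P4

fun eps :: "pt \<Rightarrow> bit" where
  "eps P1 = 0"
| "eps P2 = 1"
| "eps P3 = 1"
| "eps P4 = 0"

definition eta :: "bit \<Rightarrow> pt" where
  "eta t = (if t = 0 then P4 else P3)"

definition H5 :: "pt \<Rightarrow> pt \<Rightarrow> pt \<Rightarrow> pt \<Rightarrow> pt \<Rightarrow> pt" where
  "H5 x1 x2 x3 x4 x5 =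
     (if x1 = P1 \<and> x2 = P1 \<and> x3 = P1 \<and> x4 = P1 \<and> x5 = P1 then P1
      else if x1 = P2 \<and> x2 = P2 \<and> x3 = P2 \<and> x4 = P2 \<and> x5 = P2 then P2
      else eta (eps x1 + eps x2 + eps x3 + eps x4 + eps x5))"

definition parity :: "pt rel" where
  "parity = (\<Union>B\<in>{{P1, P4}, {P2, P3}}. B \<times> B)"

definition add5 :: "bit \<Rightarrow> bit \<Rightarrow> bit \<Rightarrow> bit \<Rightarrow> bit \<Rightarrow> bit" where
  "add5 t1 t2 t3 t4 t5 = t1 + t2 + t3 + t4 + t5"

type_synonym 'a op5 = "'a \<Rightarrow> 'a \<Rightarrow> 'a \<Rightarrow> 'a \<Rightarrow> 'a \<Rightarrow> 'a"

text \<open>The set extension \<open>f\<^sup>#\<close> of a five-ary operation.\<close>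

definition set_ext5 :: "'a op5 \<Rightarrow> 'a set op5" where
  "set_ext5 f A B C D F = {f a b c d g | a b c d g. a \<in> A \<and> b \<in> B \<and> c \<in> C \<and> d \<in> D \<and> g \<in> F}"

definition congruence5 :: "'a op5 \<Rightarrow> 'a rel \<Rightarrow> bool" where
  "congruence5 f r \<longleftrightarrow> equiv UNIV r \<and>
     (\<forall>a b c d g a' b' c' d' g'.
        (a, a') \<in> r \<and> (b, b') \<in> r \<and> (c, c') \<in> r \<and> (d, d') \<in> r \<and> (g, g') \<in> r \<longrightarrow>
        (f a b c d g, f a' b' c' d' g') \<in> r)"

text \<open>Operation of the quotient algebra on \<^term>\<open>UNIV // r\<close>. When \<open>r\<close> is a congruence, the
  values of \<open>f\<close> on representatives of five classes lie in a single class, and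
  \<open>quotient5 f r\<close> returns that class.\<close>

definition quotient5 :: "'a op5 \<Rightarrow> 'a rel \<Rightarrow> 'a set op5" where
  "quotient5 f r A B C D F = r `` set_ext5 f A B C D F"

definition hom5_on :: "'a set \<Rightarrow> 'a op5 \<Rightarrow> 'b op5 \<Rightarrow> ('a \<Rightarrow> 'b) \<Rightarrow> bool" where
  "hom5_on S f g h \<longleftrightarrow>
     (\<forall>x1\<in>S. \<forall>x2\<in>S. \<forall>x3\<in>S. \<forall>x4\<in>S. \<forall>x5\<in>S.
        f x1 x2 x3 x4 x5 \<in> S \<and>
        h (f x1 x2 x3 x4 x5) = g (h x1) (h x2) (h x3) (h x4) (h x5))"

definition kernel_rel :: "('a \<Rightarrow> 'b) \<Rightarrow> 'a rel" where
  "kernel_rel h = {(x, y). h x = h y}"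

text \<open>The map on classes induced by \<open>h\<close>; meaningful on classes on which \<open>h\<close> is constant.\<close>

definition induced_map :: "('a \<Rightarrow> 'b) \<Rightarrow> 'a set \<Rightarrow> 'b" where
  "induced_map h C = the_elem (h ` C)"

definition single_variable :: "('a \<Rightarrow> 'b \<Rightarrow> bool) \<Rightarrow> bool" where
  "single_variable \<phi> \<longleftrightarrow> (\<exists>p. \<phi> = (\<lambda>A B. p A)) \<or> (\<exists>q. \<phi> = (\<lambda>A B. q B))"

end

theory Submission
  imports Defs
begin

text \<open>With three of the arguments equal to 4, neither exceptional clause of \<open>H5\<close> applies, so
  \<open>H5 a 4 b 4 4 = 4\<close> exactly when \<open>\<epsilon> a = \<epsilon> b\<close>; hence \<open>R\<close> relates \<open>A\<close> and \<open>B\<close> iff \<open>\<epsilon>\<close> takes a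
  common constant value on them. The exceptional clauses respect \<open>\<epsilon>\<close> because five is odd, so \<open>\<epsilon>\<close>
  is a homomorphism and the quotient statements are the first isomorphism theorem. A rectangle, or
  a conjunction of one-variable conditions, containing \<open>(A, B)\<close> and \<open>(A', B')\<close> also contains
  \<open>(A, B')\<close>, whereas \<open>R\<close> contains \<open>({1}, {1})\<close> and \<open>({2}, {2})\<close> but not \<open>({1}, {2})\<close>.\<close>

section \<open>First isomorphism theorem for five-ary operations\<close>

lemma equiv_kernel_rel: "equiv UNIV (kernel_rel h)"
  by (auto simp: kernel_rel_def intro!: equivI refl_onI symI transI)

lemma congruence5_kernel_rel:
  assumes "hom5_on UNIV f g h"
  shows "congruence5 f (kernel_rel h)"
  using assms equiv_kernel_rel[of h]
  by (simp add: congruence5_def hom5_on_def kernel_rel_def)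

text \<open>\<open>h\<close> is constant on a kernel class, so \<open>the_elem\<close> is applied to
  a genuine singleton.\<close>

lemma induced_map_kernel_class: "induced_map h (kernel_rel h `` {x}) = h x"
proof -
  have "h ` (kernel_rel h `` {x}) = {h x}"
    by (auto simp: kernel_rel_def)
  then show ?thesis
    by (simp add: induced_map_def)
qed

lemma bij_betw_induced_map:
  assumes "surj h"
  shows "bij_betw (induced_map h) (UNIV // kernel_rel h) UNIV"
proof (rule bij_betw_imageI)
  show "inj_on (induced_map h) (UNIV // kernel_rel h)"
  proof (rule inj_onI)
    fix A B
    assume "A \<in> UNIV // kernel_rel h" "B \<in> UNIV // kernel_rel h"
      and eq: "induced_map h A = induced_map h B"
    then obtain x y where "A = kernel_rel h `` {x}" "B = kernel_rel h `` {y}"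
      by (auto elim!: quotientE)
    with eq show "A = B"
      \<comment> \<open>\<open>kernel_rel\<close> is unfolded only after the induced map has been
        evaluated, since that evaluation needs the classes in folded form.\<close>
      by (simp add: induced_map_kernel_class) (simp add: kernel_rel_def)
  qed
  show "induced_map h ` (UNIV // kernel_rel h) = UNIV"
  proof (intro set_eqI iffI UNIV_I)
    fix t
    obtain x where "t = h x"
      using assms by (metis surjD)
    then show "t \<in> induced_map h ` (UNIV // kernel_rel h)"
      by (metis imageI induced_map_kernel_class quotientI UNIV_I)
  qed
qed

text \<open>Compatibility and transitivity keep all values inside one class; by reflexivity
  \<open>f a b c d g\<close> is itself a value, so its whole class is reached.\<close>

lemma quotient5_classes:
  assumes "congruence5 f r"
  shows "quotient5 f r (r `` {a}) (r `` {b}) (r `` {c}) (r `` {d}) (r `` {g}) = r `` {f a b c d g}"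
proof -
  have eq: "equiv UNIV r" and comp: "\<And>a' b' c' d' g'.
      (a, a') \<in> r \<Longrightarrow> (b, b') \<in> r \<Longrightarrow> (c, c') \<in> r \<Longrightarrow> (d, d') \<in> r \<Longrightarrow> (g, g') \<in> r \<Longrightarrow>
      (f a b c d g, f a' b' c' d' g') \<in> r"
    using assms by (simp_all add: congruence5_def)
  have refl: "(x, x) \<in> r" for x
    using eq by (meson UNIV_I equivE refl_onD)
  have trans: "(x, y) \<in> r \<Longrightarrow> (y, z) \<in> r \<Longrightarrow> (x, z) \<in> r" for x y z
    using eq by (meson equivE transD)
  show ?thesis
  proof
    show "quotient5 f r (r `` {a}) (r `` {b}) (r `` {c}) (r `` {d}) (r `` {g}) \<subseteq> r `` {f a b c d g}"
      by (auto simp: quotient5_def set_ext5_def intro: trans comp)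
    have "f a b c d g \<in> set_ext5 f (r `` {a}) (r `` {b}) (r `` {c}) (r `` {d}) (r `` {g})"
      unfolding set_ext5_def using refl by blast
    then show "r `` {f a b c d g} \<subseteq> quotient5 f r (r `` {a}) (r `` {b}) (r `` {c}) (r `` {d}) (r `` {g})"
      unfolding quotient5_def by blast
  qed
qed

lemma hom5_on_induced_map:
  assumes "hom5_on UNIV f g h"
  shows "hom5_on (UNIV // kernel_rel h) (quotient5 f (kernel_rel h)) g (induced_map h)"
  unfolding hom5_on_def
proof (intro ballI)
  fix A B C D F
  assume "A \<in> UNIV // kernel_rel h" "B \<in> UNIV // kernel_rel h" "C \<in> UNIV // kernel_rel h"
    "D \<in> UNIV // kernel_rel h" "F \<in> UNIV // kernel_rel h"
  then obtain a b c d k where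
    "A = kernel_rel h `` {a}" "B = kernel_rel h `` {b}" "C = kernel_rel h `` {c}"
    "D = kernel_rel h `` {d}" "F = kernel_rel h `` {k}"
    by (auto elim!: quotientE)
  with assms show "quotient5 f (kernel_rel h) A B C D F \<in> UNIV // kernel_rel h \<and>
      induced_map h (quotient5 f (kernel_rel h) A B C D F) =
      g (induced_map h A) (induced_map h B) (induced_map h C) (induced_map h D) (induced_map h F)"
    by (simp add: quotient5_classes[OF congruence5_kernel_rel[OF assms]] induced_map_kernel_class
        quotientI hom5_on_def)
qed

text \<open>A condition on the first variable is inherited from \<open>(A, B)\<close>, one on the
  second from \<open>(A', B')\<close>.\<close>

lemma conjunction_single_variable_exchange:
  assumes single: "\<forall>\<phi>\<in>\<Phi>. single_variable \<phi>"
    and R: "R = {(A, B). \<forall>\<phi>\<in>\<Phi>. \<phi> A B}"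
    and "(A, B) \<in> R" "(A', B') \<in> R"
  shows "(A, B') \<in> R"
proof -
  have "\<phi> A B'" if "\<phi> \<in> \<Phi>" for \<phi>
  proof -
    have "\<phi> A B" "\<phi> A' B'"
      using assms(2-4) that by auto
    moreover have "single_variable \<phi>"
      using single that by blast
    ultimately show ?thesis
      by (auto simp: single_variable_def)
  qed
  then show ?thesis
    unfolding R by blast
qed

section \<open>The parity map as a surjective homomorphism\<close>

lemma eps_eta [simp]: "eps (eta t) = t"
  by (cases t) (simp_all add: eta_def)

lemma hom5_on_eps: "hom5_on UNIV H5 add5 eps"
proof -
  have "eps (H5 a b c d g) = add5 (eps a) (eps b) (eps c) (eps d) (eps g)" for a b c d g
  proof -
    consider "a = P1 \<and> b = P1 \<and> c = P1 \<and> d = P1 \<and> g = P1"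
      | "a = P2 \<and> b = P2 \<and> c = P2 \<and> d = P2 \<and> g = P2"
      | "H5 a b c d g = eta (eps a + eps b + eps c + eps d + eps g)"
      unfolding H5_def by metis
    then show ?thesis
    proof cases
      case 3
      then show ?thesis
        by (simp only: eps_eta add5_def)
    \<comment> \<open>In the exceptional cases five zeros sum to 0 and five ones sum to 1 modulo
      2.\<close>
    qed (simp_all add: H5_def add5_def)
  qed
  then show ?thesis
    by (simp add: hom5_on_def)
qed

lemma surj_eps: "surj eps"
  by (rule surjI) (rule eps_eta)

lemma kernel_rel_eps: "kernel_rel eps = parity"
proof -
  have "(x, y) \<in> kernel_rel eps \<longleftrightarrow> (x, y) \<in> parity" for x y
    by (cases x; cases y) (simp_all add: kernel_rel_def parity_def)
  then show ?thesis
    by auto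
qed

section \<open>The relation expressed through parities\<close>

lemma H5_eq_P4_iff: "H5 a P4 b P4 P4 = P4 \<longleftrightarrow> eps a = eps b"
  by (cases a; cases b) (simp_all add: H5_def eta_def)

lemma set_ext5_H5_subset_iff:
  "set_ext5 H5 A {P4} B {P4} {P4} \<subseteq> {P4} \<longleftrightarrow> (\<forall>a\<in>A. \<forall>b\<in>B. eps a = eps b)"
proof -
  have "set_ext5 H5 A {P4} B {P4} {P4} = {H5 a P4 b P4 P4 | a b. a \<in> A \<and> b \<in> B}"
    by (simp add: set_ext5_def)
  also have "\<dots> \<subseteq> {P4} \<longleftrightarrow> (\<forall>a\<in>A. \<forall>b\<in>B. H5 a P4 b P4 P4 = P4)"
    by blast
  finally show ?thesis
    by (simp only: H5_eq_P4_iff)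
qed

lemma eps_eq_0_iff: "eps x = 0 \<longleftrightarrow> x \<in> {P1, P4}"
  by (cases x) simp_all

lemma eps_eq_1_iff: "eps x = 1 \<longleftrightarrow> x \<in> {P2, P3}"
  by (cases x) simp_all

lemma eps_constant_iff:
  assumes "A \<noteq> {}" "B \<noteq> {}"
  shows "(\<forall>a\<in>A. \<forall>b\<in>B. eps a = eps b) \<longleftrightarrow>
    (A \<subseteq> {P1, P4} \<and> B \<subseteq> {P1, P4}) \<or> (A \<subseteq> {P2, P3} \<and> B \<subseteq> {P2, P3})" (is "?L \<longleftrightarrow> ?R")
proof
  assume L: ?L
  obtain b where "b \<in> B"
    using assms by blast
  \<comment> \<open>Elements of \<open>A\<close> agree with \<open>b\<close> directly; elements of
    \<open>B\<close> agree with it through some element of the nonempty set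
    \<open>A\<close>.\<close>
  with L assms have "\<forall>x\<in>A \<union> B. eps x = eps b"
    by (metis Un_iff ex_in_conv)
  moreover have "eps b = 0 \<or> eps b = 1"
    by (cases b) simp_all
  ultimately have "(\<forall>x\<in>A \<union> B. eps x = 0) \<or> (\<forall>x\<in>A \<union> B. eps x = 1)"
    by metis
  then show ?R
    unfolding eps_eq_0_iff eps_eq_1_iff by blast
next
  assume ?R
  then show ?L
    unfolding subset_iff eps_eq_0_iff[symmetric] eps_eq_1_iff[symmetric] by auto
qed

theorem proposition7p2:
  fixes E Od e :: "pt set" and R :: "pt set rel"
  assumes E: "E = {P1, P4}"
    and Od: "Od = {P2, P3}"
    and e: "e = {P4}"
    and R: "R = {(A, B). set_ext5 H5 A e B e e \<subseteq> e}"
  shows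
    "R = ({{}} \<times> Pow UNIV) \<union> (Pow UNIV \<times> {{}})
         \<union> {(A, B). A \<noteq> {} \<and> B \<noteq> {} \<and> A \<subseteq> E \<and> B \<subseteq> E}
         \<union> {(A, B). A \<noteq> {} \<and> B \<noteq> {} \<and> A \<subseteq> Od \<and> B \<subseteq> Od}
     \<and> congruence5 H5 parity
     \<and> (\<forall>x y. ({x}, {y}) \<in> R \<longleftrightarrow> (x, y) \<in> parity)
     \<and> surj eps
     \<and> hom5_on UNIV H5 add5 eps
     \<and> kernel_rel eps = parity
     \<and> (\<forall>x. induced_map eps (parity `` {x}) = eps x)
     \<and> bij_betw (induced_map eps) (UNIV // parity) UNIV
     \<and> hom5_on (UNIV // parity) (quotient5 H5 parity) add5 (induced_map eps)
     \<and> (\<nexists>U V. R = U \<times> V)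
     \<and> (\<nexists>\<Phi>. (\<forall>\<phi>\<in>\<Phi>. single_variable \<phi>) \<and> R = {(A, B). \<forall>\<phi>\<in>\<Phi>. \<phi> A B})"
proof (intro conjI)
  have mem: "(A, B) \<in> R \<longleftrightarrow> (\<forall>a\<in>A. \<forall>b\<in>B. eps a = eps b)" for A B
    by (simp add: R e set_ext5_H5_subset_iff)
  show "R = ({{}} \<times> Pow UNIV) \<union> (Pow UNIV \<times> {{}})
         \<union> {(A, B). A \<noteq> {} \<and> B \<noteq> {} \<and> A \<subseteq> E \<and> B \<subseteq> E}
         \<union> {(A, B). A \<noteq> {} \<and> B \<noteq> {} \<and> A \<subseteq> Od \<and> B \<subseteq> Od}" (is "R = ?S")
  proof (rule set_eqI, unfold split_paired_all)
    fix A B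
    show "(A, B) \<in> R \<longleftrightarrow> (A, B) \<in> ?S"
    \<comment> \<open>With an empty component the parity condition is vacuous, which accounts for
      the first two pieces of the union.\<close>
    proof (cases "A = {} \<or> B = {}")
      case True
      then show ?thesis
        by (auto simp: mem)
    next
      case False
      then show ?thesis
        by (simp add: mem eps_constant_iff E Od)
    qed
  qed
  \<comment> \<open>The congruence and quotient claims are the general kernel facts for
    \<open>eps\<close>, transported along \<open>kernel_rel_eps\<close>.\<close>
  show "congruence5 H5 parity"
    using congruence5_kernel_rel[OF hom5_on_eps] by (simp add: kernel_rel_eps)
  show "\<forall>x y. ({x}, {y}) \<in> R \<longleftrightarrow> (x, y) \<in> parity"
    by (simp add: mem kernel_rel_eps[symmetric] kernel_rel_def)
  show "surj eps"
    by (rule surj_eps)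
  show "hom5_on UNIV H5 add5 eps"
    by (rule hom5_on_eps)
  show "kernel_rel eps = parity"
    by (rule kernel_rel_eps)
  show "\<forall>x. induced_map eps (parity `` {x}) = eps x"
    using induced_map_kernel_class[of eps] by (simp add: kernel_rel_eps)
  show "bij_betw (induced_map eps) (UNIV // parity) UNIV"
    using bij_betw_induced_map[OF surj_eps] by (simp add: kernel_rel_eps)
  show "hom5_on (UNIV // parity) (quotient5 H5 parity) add5 (induced_map eps)"
    using hom5_on_induced_map[OF hom5_on_eps] by (simp add: kernel_rel_eps)
  \<comment> \<open>\<open>P1\<close> and \<open>P2\<close> have opposite parities; these three
    facts refute both the rectangle and the conjunction.\<close>
  have R11: "({P1}, {P1}) \<in> R" and R22: "({P2}, {P2}) \<in> R" and R12: "({P1}, {P2}) \<notin> R"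
    by (simp_all add: mem)
  show "\<nexists>U V. R = U \<times> V"
    using R11 R22 R12 by blast
  show "\<nexists>\<Phi>. (\<forall>\<phi>\<in>\<Phi>. single_variable \<phi>) \<and> R = {(A, B). \<forall>\<phi>\<in>\<Phi>. \<phi> A B}"
  proof
    assume "\<exists>\<Phi>. (\<forall>\<phi>\<in>\<Phi>. single_variable \<phi>) \<and> R = {(A, B). \<forall>\<phi>\<in>\<Phi>. \<phi> A B}"
    then obtain \<Phi> where single: "\<forall>\<phi>\<in>\<Phi>. single_variable \<phi>"
      and conj: "R = {(A, B). \<forall>\<phi>\<in>\<Phi>. \<phi> A B}"
      by (elim exE conjE)
    have "({P1}, {P2}) \<in> R"
      by (rule conjunction_single_variable_exchange[OF single conj R11 R22])
    with R12 show False ..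
  qed
qed

end
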